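(* Let $p$ be an odd prime, and let $s$ be an integer with $1\leq s\leq 8p$, $s\equiv 1\pmod 8$, and $\left(\frac{s}{p}\right)_L=-1$. Then for all integers $n\geq 0$, $$\overline{R_6^\ast}\left(18pn+\frac{9s-1}{4}\right)\equiv 0 \pmod{8}.$$ Furthermore, if $\tau(p)\equiv 0\pmod 2$, then for all integers $n\geq 0$ and $k\geq 1$, $$\overline{R_6^\ast}\left(18p^{2k+1}n+\frac{9sp^{2k}-1}{4}\right)\equiv 0 \pmod{8}.$$
   Context: An overpartition of $n$ is a partition of $n$ in which the first occurrence of each part size may optionally be overlined. For a positive integer $\ell$, $\overline{R_\ell^\ast}(n)$ denotes the number of overpartitions of $n$ in which no non-overlined part is divisible by $\ell$. Equivalently, with $f_k:=\prod_{i\geq 1}(1-q^{ki})$, one has $\sum_{n\geq 0}\overline{R_\ell^\ast}(n)q^n = \frac{f_2 f_\ell}{f_1^2}$. $\left(\frac{s}{p}\right)_L$ is the Legendre symbol. $\tau(n)$ is Ramanujan's tau function, defined by $q\prod_{i\geq1}(1-q^i)^{24}=\sum_{n\geq 1}\tau(n)q^n$. *)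

theory Defs
  imports "HOL-Analysis.Analysis" "HOL-Computational_Algebra.Computational_Algebra"
    "HOL-Number_Theory.Number_Theory"
begin

text \<open>
  An overpartition is encoded as a pair \<open>(M, S)\<close>: \<open>M\<close> is the multiset of all parts and \<open>S\<close>
  the set of those part sizes whose first occurrence is overlined. The multiset of
  non-overlined parts is therefore \<open>M - mset_set S\<close>.
\<close>

definition overpartitions :: "nat \<Rightarrow> (nat multiset \<times> nat set) set" where
  "overpartitions n = {(M, S). 0 \<notin># M \<and> \<Sum>\<^sub># M = n \<and> S \<subseteq> set_mset M}"

definition non_overlined :: "nat multiset \<times> nat set \<Rightarrow> nat multiset" where
  "non_overlined \<pi> = fst \<pi> - mset_set (snd \<pi>)"

definition R_star :: "nat \<Rightarrow> nat \<Rightarrow> nat" where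
  "R_star l n = card {\<pi> \<in> overpartitions n. \<forall>d \<in># non_overlined \<pi>. \<not> l dvd d}"

text \<open>
  The product is the limit in the X-adic metric on formal power series; the factor for
  \<open>i\<close> is indexed by \<open>i - 1\<close>.
\<close>

definition ramanujan_tau :: "nat \<Rightarrow> int" where
  "ramanujan_tau n = fps_nth (fps_X * (\<Prod>i. (1 - fps_X ^ Suc i) ^ 24)) n"

text \<open>The counted sets are finite, so \<open>card\<close> does not degenerate.\<close>

lemma finite_overpartitions: "finite (overpartitions n)"
proof -
  let ?L = "{xs :: nat list. set xs \<subseteq> {..n} \<and> length xs \<le> n}"
  have "overpartitions n \<subseteq> (mset ` ?L) \<times> Pow {..n}"
  proof
    fix \<pi> assume "\<pi> \<in> overpartitions n"
    then obtain M S where \<pi>: "\<pi> = (M, S)" and M: "0 \<notin># M" "\<Sum>\<^sub># M = n" "S \<subseteq> set_mset M"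
      by (auto simp: overpartitions_def)
    have sz: "size M \<le> \<Sum>\<^sub># M" if "0 \<notin># M" for M :: "nat multiset"
      using that by (induction M) auto
    have el: "x \<le> n" if "x \<in># M" for x
      using that M(2) by (auto dest!: multi_member_split)
    obtain xs where xs: "mset xs = M" by (metis ex_mset)
    then have "xs \<in> ?L" using el sz[OF M(1)] M(2) by auto
    with xs have "M \<in> mset ` ?L" by blast
    moreover have "S \<in> Pow {..n}" using M(3) el by auto
    ultimately show "\<pi> \<in> (mset ` ?L) \<times> Pow {..n}" unfolding \<pi> by (rule SigmaI)
  qed
  moreover have "finite ?L" by (simp add: finite_lists_length_le)
  ultimately show ?thesis
    by (meson finite_SigmaI finite_Pow_iff finite_atMost finite_imageI finite_subset)
qed

text \<open>The product defining \<open>ramanujan_tau\<close> converges, with the coefficients of its truncations.\<close>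

lemma tau_product_has_prod:
  defines "g \<equiv> \<lambda>i. (1 - fps_X ^ Suc i) ^ 24 :: int fps"
  shows "g has_prod Abs_fps (\<lambda>k. fps_nth (\<Prod>i\<le>k. g i) k)"
proof -
  have step: "fps_nth (f * g m) k = fps_nth f k" if "k \<le> m" for f m k
  proof -
    have "1 - fps_X ^ Suc m - 1 dvd (1 - fps_X ^ Suc m :: int fps) ^ 24 - 1"
      by (metis dvd_triv_left power_diff_1_eq)
    then have "fps_X ^ Suc m dvd g m - 1"
      by (simp add: g_def del: power_Suc)
    then obtain h where h: "g m = 1 + fps_X ^ Suc m * h"
      by (metis add.commute diff_add_cancel dvdE)
    have "f * g m = f + fps_X ^ Suc m * (h * f)"
      by (simp add: h algebra_simps del: power_Suc)
    then show ?thesis using that by (simp add: fps_X_power_mult_nth del: power_Suc)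
  qed
  have stab: "fps_nth (\<Prod>i\<le>k + d. g i) k = fps_nth (\<Prod>i\<le>k. g i) k" for k d
    by (induction d) (simp_all add: step)
  have "(\<lambda>n. \<Prod>i\<le>n. g i) \<longlonglongrightarrow> Abs_fps (\<lambda>k. fps_nth (\<Prod>i\<le>k. g i) k)"
  proof (rule tendsto_fpsI)
    fix k
    show "\<forall>\<^sub>F n in sequentially. fps_nth (\<Prod>i\<le>n. g i) k
            = fps_nth (Abs_fps (\<lambda>k. fps_nth (\<Prod>i\<le>k. g i) k)) k"
      using eventually_ge_at_top[of k]
      by eventually_elim (metis fps_nth_Abs_fps le_Suc_ex stab)
  qed
  moreover have "fps_nth (Abs_fps (\<lambda>k. fps_nth (\<Prod>i\<le>k. g i) k)) 0 = 1"
    by (simp add: g_def fps_power_zeroth)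
  then have "Abs_fps (\<lambda>k. fps_nth (\<Prod>i\<le>k. g i) k) \<noteq> 0"
    by (metis fps_zero_nth zero_neq_one)
  ultimately show ?thesis by (simp add: has_prod_def raw_has_prod_def)
qed

end

theory Submission
  imports Defs
begin

text \<open>
  Let \<open>\<theta> = \<Sum>k\<ge>1. (-1)\<^sup>k q\<^bsup>k\<^sup>2\<^esup>\<close>. By Gauss, \<open>f\<^sub>1\<^sup>2 / f\<^sub>2 = 1 + 2\<theta>\<close>, so the generating function is
  \<open>f\<^sub>6 / (1 + 2\<theta>)\<close>, which is congruent to \<open>f\<^sub>6 (1 - 2\<theta> + 4\<theta>\<^sup>2)\<close> modulo 8. As \<open>f\<^sub>6\<close> is a series in \<open>q\<^sup>3\<close> and
  2 is not a square modulo 3, only \<open>4 f\<^sub>6 \<theta>\<^sup>2\<close> contributes to exponents \<open>N\<close> congruent to 2 modulo 3.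
  Modulo 2, Euler's pentagonal number theorem turns the coefficient of \<open>f\<^sub>6 \<theta>\<^sup>2\<close> at \<open>N = 18m + 2\<close> into
  the number of \<open>x, y > 0\<close> with \<open>x\<^sup>2 + 2y\<^sup>2 = 9M\<close> and \<open>x\<close> prime to 3, where \<open>M = 8m + 1\<close>. Write
  \<open>M = 3\<^sup>e n\<close> with \<open>n\<close> prime to 3. Dividing by powers of the prime \<open>1 + sqrt(-2)\<close> shows that this
  number is half the number of all integral representations of \<open>n\<close> by \<open>x\<^sup>2 + 2y\<^sup>2\<close>. The latter is a
  multiple of 4 unless \<open>n\<close> is a square, which forces \<open>M\<close> to be one. Here
  \<open>M = p\<^bsup>2k\<^esup> (8pn + s)\<close> is not a square, because \<open>s\<close> is not one modulo \<open>p\<close>.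
\<close>

subsection \<open>The generating function\<close>

text \<open>Bounding the parts by \<open>m\<close> turns the generating function into a finite
  product, built up one part size at a time.\<close>

definition bounded_overpartitions :: "nat \<Rightarrow> nat \<Rightarrow> nat \<Rightarrow> (nat multiset \<times> nat set) set" where
  "bounded_overpartitions l m n =
    {\<pi> \<in> overpartitions n. (\<forall>d \<in># non_overlined \<pi>. \<not> l dvd d) \<and> (\<forall>d \<in># fst \<pi>. d \<le> m)}"

lemma in_non_overlined_iff:
  assumes "S \<subseteq> set_mset M"
  shows "d \<in># non_overlined (M, S) \<longleftrightarrow> d \<in># M \<and> (d \<in> S \<longrightarrow> count M d \<noteq> 1)"
proof -
  have "finite S" using assms finite_subset by blast
  then show ?thesis
    using assms
    by (auto simp: non_overlined_def in_diff_count count_mset_set' Suc_le_eq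
        simp flip: count_greater_zero_iff)
qed

text \<open>A multiple of \<open>l\<close> may occur only once, and then overlined: it contributes
  \<open>1 + q ^ d\<close>, while other part sizes contribute
  \<open>(1 + q ^ d) / (1 - q ^ d)\<close>.\<close>

lemma bounded_overpartitions_iff:
  "(M, S) \<in> bounded_overpartitions l m n \<longleftrightarrow>
    \<Sum>\<^sub># M = n \<and> S \<subseteq> set_mset M \<and>
    (\<forall>d \<in># M. 0 < d \<and> d \<le> m \<and> (l dvd d \<longrightarrow> d \<in> S \<and> count M d = 1))"
  by (auto simp: bounded_overpartitions_def overpartitions_def in_non_overlined_iff intro!: gr0I)

lemma finite_bounded_overpartitions: "finite (bounded_overpartitions l m n)"
  using finite_overpartitions[of n] by (simp add: bounded_overpartitions_def)

lemma card_bounded_overpartitions: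
  assumes "n \<le> m"
  shows "card (bounded_overpartitions l m n) = R_star l n"
proof -
  have "d \<le> m" if "\<pi> \<in> overpartitions n" "d \<in># fst \<pi>" for \<pi> d
    using that assms by (auto simp: overpartitions_def dest!: multi_member_split)
  then have "bounded_overpartitions l m n = {\<pi> \<in> overpartitions n. \<forall>d \<in># non_overlined \<pi>. \<not> l dvd d}"
    by (auto simp: bounded_overpartitions_def)
  then show ?thesis by (simp add: R_star_def)
qed

text \<open>Three cases for the largest admissible part \<open>k\<close>: it is absent; it has a
  single, overlined copy, which \<open>over\<close> restores; or some copy is plain and
  \<open>plain\<close> restores one.\<close>

lemma bounded_overpartitions_Suc:
  fixes l m n :: nat
  defines "k \<equiv> Suc m"
  defines "over \<equiv> \<lambda>(M, S). (add_mset k M, insert k S)"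
    and "plain \<equiv> \<lambda>(M, S). (add_mset k M, S)"
  shows "bounded_overpartitions l k n = bounded_overpartitions l m n \<union>
    (if k \<le> n then over ` bounded_overpartitions l m (n - k) \<union>
       (if l dvd k then {} else plain ` bounded_overpartitions l k (n - k)) else {})"
    (is "?L = ?A \<union> ?B")
proof (intro subset_antisym subsetI)
  fix \<pi> assume a: "\<pi> \<in> ?L"
  obtain M S where [simp]: "\<pi> = (M, S)" by force
  note a = a[simplified, unfolded bounded_overpartitions_iff]
  show "\<pi> \<in> ?A \<union> ?B"
  proof (cases "k \<in># M")
    case False
    then have "\<pi> \<in> ?A" using a by (auto simp: bounded_overpartitions_iff k_def le_Suc_eq)
    then show ?thesis by blast
  next
    case True
    then obtain M' where M: "M = add_mset k M'" by (metis mset_add)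
    then have kn: "k \<le> n" using a by auto
    show ?thesis
    proof (cases "k \<in> S \<and> count M k = 1")
      case True
      then have "k \<notin># M'" using M by (auto simp: not_in_iff)
      then have "(M', S - {k}) \<in> bounded_overpartitions l m (n - k)"
        using a M
        by (auto simp: bounded_overpartitions_iff k_def le_Suc_eq split: if_splits)
      moreover have "\<pi> = over (M', S - {k})" using True by (auto simp: over_def M)
      ultimately show ?thesis using kn by auto
    next
      case False
      then have l: "\<not> l dvd k" using a True by auto
      \<comment> \<open>If \<open>k\<close> is overlined here, it occurs at least twice, so a copy
        survives in \<open>M'\<close> to carry the overline.\<close>
      have "S \<subseteq> set_mset M'"
      proof
        fix d assume "d \<in> S"
        then show "d \<in># M'" using a M False by (cases "d = k") (auto simp: not_in_iff)
      qed
      then have "(M', S) \<in> bounded_overpartitions l k (n - k)"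
        using a M l by (auto simp: bounded_overpartitions_iff split: if_splits)
      moreover have "\<pi> = plain (M', S)" by (simp add: plain_def M)
      ultimately show ?thesis using kn l by auto
    qed
  qed
next
  fix \<pi> assume "\<pi> \<in> ?A \<union> ?B"
  then consider "\<pi> \<in> ?A"
    | M S where "k \<le> n" "\<pi> = over (M, S)" "(M, S) \<in> bounded_overpartitions l m (n - k)"
    | M S where "k \<le> n" "\<not> l dvd k" "\<pi> = plain (M, S)" "(M, S) \<in> bounded_overpartitions l k (n - k)"
    by (auto split: if_splits)
  then show "\<pi> \<in> ?L"
  proof cases
    case 1
    then show ?thesis
      by (cases \<pi>) (auto simp: bounded_overpartitions_iff k_def)
  next
    case (2 M S)
    then have "k \<notin># M" by (auto simp: bounded_overpartitions_iff k_def)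
    with 2 show ?thesis
      by (auto simp: bounded_overpartitions_iff over_def k_def not_in_iff)
  next
    case (3 M S)
    then show ?thesis
      by (auto simp: bounded_overpartitions_iff plain_def k_def)
  qed
qed

lemma card_bounded_overpartitions_Suc:
  fixes l m n :: nat
  defines "k \<equiv> Suc m"
  shows "card (bounded_overpartitions l k n) = card (bounded_overpartitions l m n) +
    (if k \<le> n then card (bounded_overpartitions l m (n - k)) +
       (if l dvd k then 0 else card (bounded_overpartitions l k (n - k))) else 0)"
proof -
  define over :: "nat multiset \<times> nat set \<Rightarrow> nat multiset \<times> nat set"
    where "over = (\<lambda>(M, S). (add_mset k M, insert k S))"
  define plain :: "nat multiset \<times> nat set \<Rightarrow> nat multiset \<times> nat set"
    where "plain = (\<lambda>(M, S). (add_mset k M, S))"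
  let ?A = "bounded_overpartitions l m n" and ?B = "over ` bounded_overpartitions l m (n - k)"
    and ?C = "plain ` bounded_overpartitions l k (n - k)"
  have no_k: "k \<notin># M" "k \<notin> S" if "(M, S) \<in> bounded_overpartitions l m n'" for M S n'
    using that by (fastforce simp: bounded_overpartitions_iff k_def)+
  have "inj_on over (bounded_overpartitions l m (n - k))"
    unfolding inj_on_def over_def using no_k by (auto simp: insert_ident)
  then have B: "card ?B = card (bounded_overpartitions l m (n - k))" by (rule card_image)
  have "inj_on plain (bounded_overpartitions l k (n - k))" by (auto simp: inj_on_def plain_def)
  then have C: "card ?C = card (bounded_overpartitions l k (n - k))" by (rule card_image)
  have "?A \<inter> ?B = {}" "?A \<inter> ?C = {}"
    by (auto simp: over_def plain_def dest!: no_k(1)[of "add_mset k _"])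
  \<comment> \<open>A common element would keep \<open>k\<close> overlined after a plain copy is
    removed, although no copy of \<open>k\<close> is left.\<close>
  moreover have "?B \<inter> ?C = {}"
  proof -
    have False if "(M, S) \<in> bounded_overpartitions l m (n - k)"
      "(M, insert k S) \<in> bounded_overpartitions l k (n - k)" for M S
      using that no_k by (auto simp: bounded_overpartitions_iff)
    then show ?thesis by (auto simp: over_def plain_def)
  qed
  moreover have "bounded_overpartitions l k n =
      ?A \<union> (if k \<le> n then ?B \<union> (if l dvd k then {} else ?C) else {})"
    unfolding over_def plain_def k_def by (rule bounded_overpartitions_Suc)
  ultimately show ?thesis
    using B C
    by (auto simp: card_Un_disjoint finite_bounded_overpartitions Int_Un_distrib)
qed

definition overpartition_gf :: "nat \<Rightarrow> nat \<Rightarrow> int fps" where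
  "overpartition_gf l m = Abs_fps (\<lambda>n. int (card (bounded_overpartitions l m n)))"

lemma overpartition_gf_0: "overpartition_gf l 0 = 1"
proof (rule fps_ext)
  fix n
  have "bounded_overpartitions l 0 n = (if n = 0 then {({#}, {})} else {})"
  proof (rule Set.set_eqI)
    fix \<pi> :: "nat multiset \<times> nat set"
    obtain M S where "\<pi> = (M, S)" by force
    then show "\<pi> \<in> bounded_overpartitions l 0 n \<longleftrightarrow> \<pi> \<in> (if n = 0 then {({#}, {})} else {})"
      by (cases "M = {#}") (auto simp: bounded_overpartitions_iff)
  qed
  then show "fps_nth (overpartition_gf l 0) n = fps_nth 1 n" by (simp add: overpartition_gf_def)
qed

lemma overpartition_gf_Suc:
  "overpartition_gf l (Suc m) = overpartition_gf l m + fps_X ^ Suc m *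
    (overpartition_gf l m + (if l dvd Suc m then 0 else overpartition_gf l (Suc m)))"
  by (rule fps_ext)
    (simp add: overpartition_gf_def card_bounded_overpartitions_Suc[of l m] fps_X_power_mult_nth
      not_less del: power_Suc)

text \<open>Finite form of f_2 f_l / f_1^2 with a denominator cleared, since the product of
  \<open>1 + q ^ i\<close> tends to f_2 / f_1.\<close>

lemma overpartition_gf_mult:
  "overpartition_gf l m * (\<Prod>i=1..m. 1 - fps_X ^ i) =
    (\<Prod>i=1..m. 1 + fps_X ^ i) * (\<Prod>i | i \<in> {1..m} \<and> l dvd i. 1 - fps_X ^ i)"
proof (induction m)
  case 0
  show ?case by (simp add: overpartition_gf_0)
next
  case (Suc m)
  have *: "{i \<in> {1..Suc m}. l dvd i} =
      (if l dvd Suc m then insert (Suc m) {i \<in> {1..m}. l dvd i} else {i \<in> {1..m}. l dvd i})"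
    by (auto simp: le_Suc_eq)
  \<comment> \<open>The recursion has the new series on both sides unless
    \<open>l dvd Suc m\<close>; collecting it yields the factor
    \<open>1 - fps_X ^ Suc m\<close>.\<close>
  have "overpartition_gf l (Suc m) * (if l dvd Suc m then 1 else 1 - fps_X ^ Suc m) =
      overpartition_gf l m * (1 + fps_X ^ Suc m)"
    using overpartition_gf_Suc[of l m] by (auto simp: algebra_simps simp del: power_Suc)
  then have "overpartition_gf l (Suc m) * (1 - fps_X ^ Suc m) =
      overpartition_gf l m * (1 + fps_X ^ Suc m) * (if l dvd Suc m then 1 - fps_X ^ Suc m else 1)"
    by (auto simp del: power_Suc)
  then have "overpartition_gf l (Suc m) * (\<Prod>i=1..Suc m. 1 - fps_X ^ i) =
      (overpartition_gf l m * (\<Prod>i=1..m. 1 - fps_X ^ i)) * (1 + fps_X ^ Suc m) *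
      (if l dvd Suc m then 1 - fps_X ^ Suc m else 1)"
    by (simp add: mult_ac del: power_Suc)
  also have "\<dots> = (\<Prod>i=1..Suc m. 1 + fps_X ^ i) * (\<Prod>i | i \<in> {1..Suc m} \<and> l dvd i. 1 - fps_X ^ i)"
    unfolding Suc.IH * by (simp add: mult_ac del: power_Suc)
  finally show ?case .
qed

subsection \<open>Finite forms of the identities of Gauss and Euler\<close>

text \<open>
  Both identities follow Shanks: the difference of two consecutive right-hand sides telescopes in \<open>j\<close>.
  Letting \<open>n\<close> tend to infinity leaves only the product standing for \<open>j = 0\<close>.
\<close>

lemma finite_gauss_identity:
  fixes q :: "'a :: comm_ring_1"
  shows "(\<Prod>i=1..n. 1 + q ^ i) * (1 + 2 * (\<Sum>k=1..n. (-1) ^ k * q ^ k\<^sup>2)) =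
    (\<Prod>i=1..n. 1 - q ^ i) + 2 * (\<Sum>j=1..n. (-1) ^ j * (\<Prod>i=1..<j. 1 + q ^ i) *
      (\<Prod>i=Suc j..n. 1 - q ^ i) * q ^ (j * (n + 1)))"
proof (induction n)
  case 0
  show ?case by simp
next
  case (Suc m)
  define n where "n = Suc m"
  define D where "D = (\<lambda>j. \<Prod>i=1..<j. 1 + q ^ i)"
  define Q where "Q = (\<lambda>j n. \<Prod>i=Suc j..n. 1 - q ^ i)"
  define H where "H = (\<lambda>n. Q 0 n + 2 * (\<Sum>j=1..n. (-1) ^ j * D j * Q j n * q ^ (j * (n + 1))))"
  \<comment> \<open>\<open>W\<close> is chosen so that summand \<open>j\<close> of
    \<open>H n\<close> minus \<open>1 + q ^ n\<close> times that of \<open>H m\<close> equals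
    \<open>W (Suc j) - W j\<close>; the scaling matches the new factor on the left-hand
    side.\<close>
  define W where "W = (\<lambda>j. (-1) ^ j * D j * Q (j - 1) m * q ^ (j * n))"
  have Qn: "Q j n = Q j m * (1 - q ^ n)" if "j \<le> m" for j
    using that by (simp add: Q_def n_def mult_ac)
  have Qj: "Q (j - Suc 0) m = (1 - q ^ j) * Q j m" if "1 \<le> j" "j \<le> m" for j
    using that by (simp add: Q_def prod.atLeast_Suc_atMost)
  have DSuc: "D (Suc j) = D j * (1 + q ^ j)" if "1 \<le> j" for j
    using that by (simp add: D_def)
  have step: "(-1) ^ j * D j * Q j n * q ^ (j * (n + 1)) -
      (1 + q ^ n) * ((-1) ^ j * D j * Q j m * q ^ (j * n)) = W (Suc j) - W j"
    if "1 \<le> j" "j \<le> m" for j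
    by (simp add: W_def Qn[OF that(2)] Qj[OF that] DSuc[OF that(1)] power_add algebra_simps)
  have "H n - (1 + q ^ n) * H m = Q 0 n - (1 + q ^ n) * Q 0 m + 2 *
      ((\<Sum>j=1..m. (-1) ^ j * D j * Q j n * q ^ (j * (n + 1)) -
        (1 + q ^ n) * ((-1) ^ j * D j * Q j m * q ^ (j * n))) +
       (-1) ^ n * D n * Q n n * q ^ (n * (n + 1)))"
    by (simp add: H_def n_def sum_subtractf sum_distrib_left algebra_simps)
  also have "(\<Sum>j=1..m. (-1) ^ j * D j * Q j n * q ^ (j * (n + 1)) -
        (1 + q ^ n) * ((-1) ^ j * D j * Q j m * q ^ (j * n))) = (\<Sum>j=1..m. W (Suc j) - W j)"
    using step by (intro sum.cong) auto
  also have "\<dots> = W n - W 1"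
    unfolding n_def by (rule sum_Suc_diff) simp
  also have "W n = (-1) ^ n * D n * q ^ (n * n)" by (simp add: W_def Q_def n_def)
  \<comment> \<open>This cancels the \<open>j = 0\<close> terms, as
    \<open>Q 0 n - (1 + q ^ n) * Q 0 m = - 2 * q ^ n * Q 0 m\<close>.\<close>
  also have "W 1 = - Q 0 m * q ^ n" by (simp add: W_def D_def)
  also have "Q n n = 1" by (simp add: Q_def)
  finally have "H n - (1 + q ^ n) * H m = 2 * ((-1) ^ n * q ^ n\<^sup>2) * (D n * (1 + q ^ n))"
    by (simp add: Qn power_add power2_eq_square algebra_simps)
  also have "D n * (1 + q ^ n) = (\<Prod>i=1..n. 1 + q ^ i)"
    unfolding D_def n_def by (simp add: atLeastLessThanSuc_atLeastAtMost)
  finally have *: "H n = (1 + q ^ n) * H m + 2 * ((-1) ^ n * q ^ n\<^sup>2) * (\<Prod>i=1..n. 1 + q ^ i)"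
    by (simp add: algebra_simps)
  have "H m = (\<Prod>i=1..m. 1 + q ^ i) * (1 + 2 * (\<Sum>k=1..m. (-1) ^ k * q ^ k\<^sup>2))"
    using Suc.IH by (simp add: H_def D_def Q_def)
  then have "H n = (\<Prod>i=1..n. 1 + q ^ i) * (1 + 2 * (\<Sum>k=1..n. (-1) ^ k * q ^ k\<^sup>2))"
    unfolding * by (simp add: n_def algebra_simps del: power_Suc)
  then show ?case by (simp add: H_def D_def Q_def n_def)
qed

lemma finite_pentagonal_identity:
  fixes q :: "'a :: comm_ring_1"
  shows "1 + (\<Sum>k=1..n. (-1) ^ k * (q ^ (k\<^sup>2 + (k choose 2)) + q ^ (k\<^sup>2 + (Suc k choose 2)))) =
    (\<Sum>j\<le>n. (-1) ^ j * (\<Prod>i=Suc j..n. 1 - q ^ i) * q ^ (j * n + (Suc j choose 2)))"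
proof (induction n)
  case 0
  show ?case by (simp add: numeral_2_eq_2)
next
  case (Suc m)
  define n where "n = Suc m"
  define Q where "Q = (\<lambda>j n. \<Prod>i=Suc j..n. 1 - q ^ i)"
  define H where "H = (\<lambda>n. \<Sum>j\<le>n. (-1) ^ j * Q j n * q ^ (j * n + (Suc j choose 2)))"
  \<comment> \<open>The value at 0 is set separately because \<open>j - 1\<close> truncates; the
    step at \<open>j = 0\<close> then reads \<open>Q 0 n - Q 0 m = W 1\<close>.\<close>
  define W where "W = (\<lambda>j. if j = 0 then 0 else (-1) ^ j * Q (j - 1) m * q ^ (j * m + (Suc j choose 2)))"
  have ch: "Suc j choose 2 = j + (j choose 2)" for j by (simp add: numeral_2_eq_2)
  have Qn: "Q j n = Q j m * (1 - q ^ n)" if "j \<le> m" for j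
    using that by (simp add: Q_def n_def mult_ac)
  have Qj: "Q (j - Suc 0) m = (1 - q ^ j) * Q j m" if "1 \<le> j" "j \<le> m" for j
    using that by (simp add: Q_def prod.atLeast_Suc_atMost)
  have step: "(-1) ^ j * Q j n * q ^ (j * n + (Suc j choose 2)) -
      (-1) ^ j * Q j m * q ^ (j * m + (Suc j choose 2)) = W (Suc j) - W j"
    if "j \<le> m" for j
  proof (cases "j = 0")
    case True
    then show ?thesis using Qn[of 0] by (simp add: W_def n_def numeral_2_eq_2 algebra_simps)
  next
    case False
    then show ?thesis using that
      by (simp add: W_def Qn Qj ch power_add flip: n_def) (simp add: n_def power_add algebra_simps)
  qed
  have "H n - H m = (\<Sum>j\<le>m. (-1) ^ j * Q j n * q ^ (j * n + (Suc j choose 2)) -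
      (-1) ^ j * Q j m * q ^ (j * m + (Suc j choose 2))) +
      (-1) ^ n * Q n n * q ^ (n * n + (Suc n choose 2))"
    by (simp add: H_def n_def sum_subtractf)
  also have "(\<Sum>j\<le>m. (-1) ^ j * Q j n * q ^ (j * n + (Suc j choose 2)) -
      (-1) ^ j * Q j m * q ^ (j * m + (Suc j choose 2))) = (\<Sum>j\<le>m. W (Suc j) - W j)"
    using step by (intro sum.cong) auto
  also have "\<dots> = W n - W 0"
    using sum_telescope[of "\<lambda>j. - W j" m] by (simp add: n_def sum_negf sum_subtractf)
  also have "W n = (-1) ^ n * q ^ (n\<^sup>2 + (n choose 2))"
    by (simp add: W_def Q_def n_def ch power2_eq_square algebra_simps)
  also have "Q n n = 1" by (simp add: Q_def)
  finally have *: "H n = H m + (-1) ^ n * (q ^ (n\<^sup>2 + (n choose 2)) + q ^ (n\<^sup>2 + (Suc n choose 2)))"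
    by (simp add: W_def power2_eq_square algebra_simps)
  have "H m = 1 + (\<Sum>k=1..m. (-1) ^ k * (q ^ (k\<^sup>2 + (k choose 2)) + q ^ (k\<^sup>2 + (Suc k choose 2))))"
    using Suc.IH by (simp add: H_def Q_def)
  then have "H n = 1 + (\<Sum>k=1..n. (-1) ^ k * (q ^ (k\<^sup>2 + (k choose 2)) + q ^ (k\<^sup>2 + (Suc k choose 2))))"
    unfolding * by (simp add: n_def)
  then show ?case by (simp add: H_def Q_def n_def)
qed

subsection \<open>Representations by \<open>x\<^sup>2 + 2y\<^sup>2\<close>\<close>

definition reps :: "int \<Rightarrow> (int \<times> int) set" where
  "reps n = {(x, y). x\<^sup>2 + 2 * y\<^sup>2 = n}"

text \<open>The \<open>x + y sqrt(-2)\<close> of norm \<open>n\<close> divisible by \<open>1 + sqrt(-2)\<close> but not by its conjugate.\<close>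

definition reps3 :: "int \<Rightarrow> (int \<times> int) set" where
  "reps3 n = {(x, y) \<in> reps n. \<not> 3 dvd x \<and> 3 dvd x - y}"

text \<open>The four sign changes act freely because no point lies on an axis.\<close>

lemma card_four_quadrants:
  fixes A :: "(int \<times> int) set"
  assumes sym: "\<And>x y. (x, y) \<in> A \<Longrightarrow> (- x, y) \<in> A" "\<And>x y. (x, y) \<in> A \<Longrightarrow> (x, - y) \<in> A"
    and nz: "\<And>x y. (x, y) \<in> A \<Longrightarrow> x \<noteq> 0 \<and> y \<noteq> 0"
  shows "card A = 4 * card {(x, y) \<in> A. x > 0 \<and> y > 0}"
proof -
  let ?P = "{(x, y) \<in> A. x > 0 \<and> y > 0}"
  let ?f = "\<lambda>((x, y), s, t). (s * x, t * y) :: int \<times> int"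
  have "bij_betw ?f (?P \<times> {1, -1 :: int} \<times> {1, -1 :: int}) A"
  proof (rule bij_betwI')
    fix a b assume "a \<in> ?P \<times> {1, -1 :: int} \<times> {1, -1 :: int}" "b \<in> ?P \<times> {1, -1 :: int} \<times> {1, -1 :: int}"
    then show "?f a = ?f b \<longleftrightarrow> a = b" by auto
  next
    fix a assume "a \<in> ?P \<times> {1, -1 :: int} \<times> {1, -1 :: int}"
    then show "?f a \<in> A" using sym by auto
  next
    fix b assume b: "b \<in> A"
    obtain x y where xy: "b = (x, y)" by force
    have "(\<bar>x\<bar>, \<bar>y\<bar>) \<in> A" using b sym by (auto simp: xy abs_if)
    then have "((\<bar>x\<bar>, \<bar>y\<bar>), sgn x, sgn y) \<in> ?P \<times> {1, -1 :: int} \<times> {1, -1 :: int}"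
      using nz[of x y] b by (auto simp: xy sgn_if)
    moreover have "b = ?f ((\<bar>x\<bar>, \<bar>y\<bar>), sgn x, sgn y)" by (simp add: xy sgn_mult_abs)
    ultimately show "\<exists>a \<in> ?P \<times> {1, -1 :: int} \<times> {1, -1 :: int}. b = ?f a" by blast
  qed
  from bij_betw_same_card[OF this] show ?thesis by (simp add: card_cartesian_product)
qed

lemma odd_square_mod_8:
  fixes x :: int
  assumes "odd x"
  shows "[x\<^sup>2 = 1] (mod 8)"
proof -
  obtain a where a: "x = 2 * a + 1" using assms oddE by blast
  obtain b where "a * (a + 1) = 2 * b" using evenE[of "a * (a + 1)"] by auto
  then have "x\<^sup>2 = 8 * b + 1" by (simp add: a power2_eq_square algebra_simps)
  then show ?thesis by (simp add: cong_def)
qed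

text \<open>3 is the product of \<open>1 + sqrt(-2)\<close> and its conjugate; the alternatives say
  which of these primes divides \<open>x + y sqrt(-2)\<close>.\<close>

lemma three_dvd_square_diff:
  fixes x y :: int
  assumes "3 dvd x\<^sup>2 + 2 * y\<^sup>2"
  shows "3 dvd x - y \<or> 3 dvd x + y"
proof -
  have "x\<^sup>2 + 2 * y\<^sup>2 = (x - y) * (x + y) + 3 * y\<^sup>2" by (simp add: power2_eq_square algebra_simps)
  then have "3 dvd (x - y) * (x + y)" using assms by (metis dvd_add_left_iff dvd_triv_left)
  then show ?thesis by (simp add: prime_dvd_mult_iff)
qed

text \<open>\<open>(x + y sqrt(-2)) (1 + sqrt(-2)) = (x - 2y) + (x + y) sqrt(-2)\<close>\<close>

lemma reps_mult_iff:
  "(x - 2 * y, x + y) \<in> reps (3 * n) \<longleftrightarrow> (x, y) \<in> reps n"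
proof -
  have "(x - 2 * y)\<^sup>2 + 2 * (x + y)\<^sup>2 = 3 * (x\<^sup>2 + 2 * y\<^sup>2)"
    by (simp add: power2_eq_square algebra_simps)
  then show ?thesis unfolding reps_def by auto
qed

text \<open>Division by \<open>1 + sqrt(-2)\<close> is a bijection; that the conjugate prime does
  not divide the element becomes \<open>\<not> 3 dvd x + y\<close> for the quotient.\<close>

lemma card_reps3_mult_3:
  "card (reps3 (3 * n)) = card {(x, y) \<in> reps n. \<not> 3 dvd x + y}"
proof -
  let ?f = "\<lambda>(x, y). (x - 2 * y, x + y) :: int \<times> int"
  let ?A = "{(x, y) \<in> reps n. \<not> 3 dvd x + y}"
  have "bij_betw ?f ?A (reps3 (3 * n))"
  proof (rule bij_betwI')
    fix a b assume "a \<in> ?A" "b \<in> ?A"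
    then show "?f a = ?f b \<longleftrightarrow> a = b" by auto
  next
    fix a assume "a \<in> ?A"
    then obtain x y where a: "a = (x, y)" "(x, y) \<in> reps n" "\<not> 3 dvd x + y" by auto
    have "\<not> 3 dvd x - 2 * y" using a(3) by presburger
    then show "?f a \<in> reps3 (3 * n)" using a by (simp add: reps3_def reps_mult_iff)
  next
    fix b assume "b \<in> reps3 (3 * n)"
    then obtain u v where b: "b = (u, v)" "(u, v) \<in> reps (3 * n)" "\<not> 3 dvd u" "3 dvd u - v"
      by (auto simp: reps3_def)
    from b(4) obtain k where "u - v = 3 * k" by (rule dvdE)
    then have k: "u = v + 3 * k" by simp
    \<comment> \<open>The pair is the quotient of \<open>u + v sqrt(-2)\<close> by
      \<open>1 + sqrt(-2)\<close>.\<close>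
    have b2: "b = ?f (v + k, - k)" by (simp add: b(1) k)
    have "(v + k, - k) \<in> reps n"
      using b(2) reps_mult_iff[of "v + k" "- k" n] by (simp add: k algebra_simps)
    moreover have "\<not> 3 dvd v + k + - k" using b(3) k by presburger
    ultimately show "\<exists>a \<in> ?A. b = ?f a" using b2 by blast
  qed
  from bij_betw_same_card[OF this] show ?thesis by simp
qed

text \<open>The quotient still has norm divisible by 3 but is prime to the conjugate, hence is
  divisible by \<open>1 + sqrt(-2)\<close> again. So repeated factors 3 do not change the
  count.\<close>

lemma card_reps3_mult_9: "card (reps3 (9 * n)) = card (reps3 (3 * n))"
proof -
  have "{(x, y) \<in> reps (3 * n). \<not> 3 dvd x + y} = reps3 (3 * n)"
  proof -
    have "\<not> 3 dvd x + y \<longleftrightarrow> \<not> 3 dvd x \<and> 3 dvd x - y" if "x\<^sup>2 + 2 * y\<^sup>2 = 3 * n" for x y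
    proof -
      have "3 dvd x - y \<or> 3 dvd x + y" using that by (intro three_dvd_square_diff) simp
      then show ?thesis by presburger
    qed
    then show ?thesis by (auto simp: reps3_def reps_def)
  qed
  then show ?thesis using card_reps3_mult_3[of "3 * n"] by simp
qed

text \<open>A norm prime to 3 rules out divisibility by the conjugate prime, so every representation
  of \<open>n\<close> is a quotient.\<close>

lemma card_reps3_mult_3_not_dvd:
  assumes "\<not> 3 dvd n"
  shows "card (reps3 (3 * n)) = card (reps n)"
proof -
  have "\<not> 3 dvd x + y" if "x\<^sup>2 + 2 * y\<^sup>2 = n" for x y
  proof
    assume "3 dvd x + y"
    moreover have "n = (x - y) * (x + y) + 3 * y\<^sup>2"
      using that by (simp add: power2_eq_square algebra_simps)
    ultimately show False using assms by simp
  qed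
  then have "{(x, y) \<in> reps n. \<not> 3 dvd x + y} = reps n" by (auto simp: reps_def)
  then show ?thesis by (simp add: card_reps3_mult_3)
qed

lemma card_reps3_mult_power_3:
  assumes "\<not> 3 dvd n"
  shows "card (reps3 (3 ^ Suc e * n)) = card (reps n)"
proof (induction e)
  case 0
  then show ?case using card_reps3_mult_3_not_dvd[OF assms] by simp
next
  case (Suc e)
  then show ?case using card_reps3_mult_9[of "3 ^ e * n"] by (simp add: mult_ac)
qed

text \<open>\<open>x = 0\<close> would make \<open>n\<close> even and \<open>y = 0\<close> would
  make it a square, so no representation lies on an axis.\<close>

lemma four_dvd_card_reps:
  assumes "odd n" "\<not> is_square n"
  shows "4 dvd card (reps n)"
proof -
  have "x \<noteq> 0 \<and> y \<noteq> 0" if "(x, y) \<in> reps n" for x y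
    using that assms by (auto simp: reps_def)
  then have "card (reps n) = 4 * card {(x, y) \<in> reps n. x > 0 \<and> y > 0}"
    by (intro card_four_quadrants) (auto simp: reps_def)
  then show ?thesis by simp
qed

lemma finite_reps: "finite (reps n)"
proof (rule finite_subset)
  show "reps n \<subseteq> {- \<bar>n\<bar>..\<bar>n\<bar>} \<times> {- \<bar>n\<bar>..\<bar>n\<bar>}"
  proof
    fix a assume "a \<in> reps n"
    then obtain x y where a: "a = (x, y)" "x\<^sup>2 + 2 * y\<^sup>2 = n" by (auto simp: reps_def)
    have "\<bar>z\<bar> \<le> z\<^sup>2" for z :: int
      using self_le_power[of "\<bar>z\<bar>" 2] by (cases "z = 0") auto
    from this[of x] this[of y] zero_le_power2[of x] zero_le_power2[of y]
    have "\<bar>x\<bar> \<le> n" "\<bar>y\<bar> \<le> n" using a(2) by linarith+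
    then show "a \<in> {- \<bar>n\<bar>..\<bar>n\<bar>} \<times> {- \<bar>n\<bar>..\<bar>n\<bar>}" using a(1) by auto
  qed
qed simp

text \<open>With all signs allowed, the solutions split into \<open>reps3 (9 * M)\<close> and its
  conjugate, but also into four equal quadrants. So the count is half of
  \<open>card (reps3 (9 * M))\<close>, which is a multiple of 4.\<close>

lemma even_card_reps_9:
  assumes M: "[M = 1] (mod 8)" "M > 0" "\<not> is_square M"
  shows "even (card {(x, y) \<in> reps (9 * M). \<not> 3 dvd x \<and> x > 0 \<and> y > 0})"
proof -
  let ?Z = "{(x, y) \<in> reps (9 * M). \<not> 3 dvd x}"
  obtain n where "M = 3 ^ multiplicity 3 M * n" and n3: "\<not> 3 dvd n"
    by (rule multiplicity_decompose'[of M 3]) (use M(2) in auto)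
  then obtain e where n: "M = 3 ^ e * n" "\<not> 3 dvd n" by blast
  have "odd M" using M(1) unfolding cong_def by presburger
  then have "odd n" using n by simp
  moreover have "\<not> is_square n"
  proof
    assume "is_square n"
    then obtain c where c: "n = c\<^sup>2" by (auto elim: is_nth_powerE)
    show False
    proof (cases "even e")
      case True
      then obtain d where "e = 2 * d" by blast
      then have "M = (3 ^ d * c)\<^sup>2" by (simp add: n c power_mult_distrib mult.commute flip: power_mult)
      then show False using M(3) by auto
    next
      case False
      then obtain d where "e = 2 * d + 1" using oddE by blast
      then have "M = 3 * (3 ^ d * c)\<^sup>2" by (simp add: n c power_mult_distrib mult.commute flip: power_mult)
      moreover have "odd (3 ^ d * c)" using c \<open>odd n\<close> by simp
      then have "[(3 ^ d * c)\<^sup>2 = 1] (mod 8)" by (rule odd_square_mod_8)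
      ultimately have "[M = 3] (mod 8)" by (metis cong_scalar_left mult.right_neutral)
      then show False using M(1) by (simp add: cong_def)
    qed
  qed
  ultimately have "4 dvd card (reps n)" by (rule four_dvd_card_reps)
  also have "card (reps n) = card (reps3 (9 * M))"
    using card_reps3_mult_power_3[OF n(2), of "Suc e"] by (simp add: n(1) mult.assoc)
  finally have 4: "4 dvd card (reps3 (9 * M))" .
  have Z: "?Z = reps3 (9 * M) \<union> (\<lambda>(x, y). (x, - y)) ` reps3 (9 * M)"
  proof (intro subset_antisym subsetI)
    fix a assume "a \<in> ?Z"
    then obtain x y where a: "a = (x, y)" "(x, y) \<in> reps (9 * M)" "\<not> 3 dvd x" by auto
    have "3 dvd x - y \<or> 3 dvd x - (- y)"
      using three_dvd_square_diff[of x y] a(2) by (auto simp: reps_def)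
    then show "a \<in> reps3 (9 * M) \<union> (\<lambda>(x, y). (x, - y)) ` reps3 (9 * M)"
    proof
      assume "3 dvd x - (- y)"
      then have "(x, - y) \<in> reps3 (9 * M)" using a by (auto simp: reps3_def reps_def)
      then show ?thesis using a(1) by (force simp: image_iff)
    qed (use a in \<open>auto simp: reps3_def\<close>)
  qed (auto simp: reps3_def reps_def)
  \<comment> \<open>Divisibility by both primes above 3 would force
    \<open>3 dvd 2 * x\<close>.\<close>
  have "reps3 (9 * M) \<inter> (\<lambda>(x, y). (x, - y)) ` reps3 (9 * M) = {}"
  proof -
    have False if "\<not> 3 dvd x" "3 dvd x - y" "3 dvd x + y" for x y :: int
      using that by presburger
    then show ?thesis by (force simp: reps3_def)
  qed
  moreover have "finite (reps3 (9 * M))"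
    by (rule finite_subset[OF _ finite_reps[of "9 * M"]]) (auto simp: reps3_def)
  moreover have "inj_on (\<lambda>(x, y). (x, - y)) (reps3 (9 * M))" by (auto simp: inj_on_def)
  ultimately have "card ?Z = 2 * card (reps3 (9 * M))"
    unfolding Z by (simp add: card_Un_disjoint card_image)
  moreover have "card ?Z = 4 * card {(x, y) \<in> ?Z. x > 0 \<and> y > 0}"
  proof (rule card_four_quadrants)
    fix x y assume a: "(x, y) \<in> ?Z"
    have "y \<noteq> 0"
    proof
      assume "y = 0"
      then have "3 dvd x\<^sup>2" using a by (auto simp: reps_def)
      then show False using a by (simp add: prime_dvd_power_iff)
    qed
    then show "x \<noteq> 0 \<and> y \<noteq> 0" using a by auto
  qed (auto simp: reps_def)
  moreover have "{(x, y) \<in> ?Z. x > 0 \<and> y > 0} =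
      {(x, y) \<in> reps (9 * M). \<not> 3 dvd x \<and> x > 0 \<and> y > 0}" by auto
  ultimately show ?thesis using 4 by auto
qed

subsection \<open>Reduction modulo 8\<close>

definition theta :: "nat \<Rightarrow> int fps" where
  "theta m = (\<Sum>k=1..m. (-1) ^ k * fps_X ^ k\<^sup>2)"

text \<open>The exponents are \<open>k (3k - 1) / 2\<close> and \<open>k (3k + 1) / 2\<close>,
  written without division; \<open>q\<close> is general so that \<open>fps_X ^ 6\<close> can be
  inserted.\<close>

definition pentagonal :: "nat \<Rightarrow> 'a :: comm_ring_1 \<Rightarrow> 'a" where
  "pentagonal n q = 1 + (\<Sum>k=1..n. (-1) ^ k * (q ^ (k\<^sup>2 + (k choose 2)) + q ^ (k\<^sup>2 + (Suc k choose 2))))"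

section \<open>Truncated identities as congruences modulo powers of q\<close>

text \<open>The \<open>j = 0\<close> summand of Euler's finite identity is the product itself; for
  \<open>j \<ge> 1\<close> the exponent is at least \<open>n + 1\<close>.\<close>

lemma power_dvd_pentagonal_diff:
  fixes q :: "'a :: comm_ring_1"
  shows "q ^ Suc n dvd pentagonal n q - (\<Prod>i=1..n. 1 - q ^ i)"
proof -
  have "pentagonal n q - (\<Prod>i=1..n. 1 - q ^ i) =
      (\<Sum>j=1..n. (-1) ^ j * (\<Prod>i=Suc j..n. 1 - q ^ i) * q ^ (j * n + (Suc j choose 2)))"
    unfolding pentagonal_def finite_pentagonal_identity
    by (simp add: atMost_atLeast0 sum.atLeast_Suc_atMost numeral_2_eq_2)
  also have "q ^ Suc n dvd \<dots>"
  proof (intro dvd_sum dvd_mult le_imp_power_dvd)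
    fix j assume "j \<in> {1..n}"
    then have "1 \<le> j" by simp
    then have "1 * n \<le> j * n" by (rule mult_right_mono) simp
    moreover have "0 < Suc j choose 2" using \<open>1 \<le> j\<close> by (simp add: zero_less_binomial)
    ultimately show "Suc n \<le> j * n + (Suc j choose 2)" by linarith
  qed
  finally show ?thesis .
qed

text \<open>This is f_1^2 / f_2 = 1 + 2\<theta> up to the terms with \<open>j \<ge> 1\<close>, whose
  exponents \<open>j * (m + 1)\<close> exceed \<open>m\<close>.\<close>

lemma fps_X_power_dvd_theta_diff:
  "fps_X ^ Suc m dvd (\<Prod>i=1..m. 1 + fps_X ^ i) * (1 + 2 * theta m) - (\<Prod>i=1..m. 1 - fps_X ^ i)"
proof -
  have "(\<Prod>i=1..m. 1 + fps_X ^ i) * (1 + 2 * theta m) - (\<Prod>i=1..m. 1 - fps_X ^ i) =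
    2 * (\<Sum>j=1..m. (-1) ^ j * (\<Prod>i=1..<j. 1 + fps_X ^ i) *
      (\<Prod>i=Suc j..m. 1 - fps_X ^ i) * fps_X ^ (j * (m + 1)))"
    unfolding theta_def finite_gauss_identity by simp
  also have "fps_X ^ Suc m dvd \<dots>"
  proof (intro dvd_mult dvd_sum le_imp_power_dvd)
    fix j assume "j \<in> {1..m}"
    then have "1 * (m + 1) \<le> j * (m + 1)" by (intro mult_right_mono) auto
    then show "Suc m \<le> j * (m + 1)" by simp
  qed
  finally show ?thesis .
qed

lemma fps_X_power_dvd_iff:
  fixes f :: "'a :: comm_ring_1 fps"
  shows "fps_X ^ n dvd f \<longleftrightarrow> (\<forall>i<n. fps_nth f i = 0)"
proof
  assume "\<forall>i<n. fps_nth f i = 0"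
  then have "f = fps_X ^ n * fps_shift n f"
    by (intro fps_ext) (simp add: fps_X_power_mult_nth)
  then show "fps_X ^ n dvd f" by (metis dvd_triv_left)
qed (auto simp: fps_X_power_mult_nth)

lemma fps_X_power_dvd_mult_cancel:
  fixes f g :: "'a :: comm_ring_1 fps"
  assumes "fps_nth f 0 = 1" "fps_X ^ n dvd f * g"
  shows "fps_X ^ n dvd g"
  unfolding fps_X_power_dvd_iff
proof (intro allI impI)
  fix i assume "i < n"
  then show "fps_nth g i = 0"
  proof (induction i rule: less_induct)
    case (less i)
    have "0 = fps_nth (f * g) i" using assms(2) less.prems by (simp add: fps_X_power_dvd_iff)
    also have "\<dots> = (\<Sum>j=0..i. fps_nth f j * fps_nth g (i - j))" by (rule fps_mult_nth)
    also have "\<dots> = fps_nth g i + (\<Sum>j=Suc 0..i. fps_nth f j * fps_nth g (i - j))"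
      by (simp add: sum.atLeast_Suc_atMost assms(1))
    also have "(\<Sum>j=Suc 0..i. fps_nth f j * fps_nth g (i - j)) = 0"
      using less by (intro sum.neutral) auto
    finally show ?case by simp
  qed
qed

text \<open>Exactly, \<open>?g * E = D * F\<close>; modulo \<open>X\<close>, Gauss replaces
  \<open>E\<close> by \<open>D * ?t\<close> and Euler replaces \<open>F\<close> by \<open>P\<close>.
  Cancelling \<open>D\<close>, whose constant term is 1, leaves the claim. The bound
  \<open>6 * n\<close> makes \<open>F\<close> run over 6 times the numbers up to
  \<open>n\<close>.\<close>

lemma overpartition_gf_theta:
  "fps_X ^ Suc (6 * n) dvd
    overpartition_gf 6 (6 * n) * (1 + 2 * theta (6 * n)) - pentagonal n (fps_X ^ 6)"
proof -
  define X :: "int fps" where "X = fps_X ^ Suc (6 * n)"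
  define D :: "int fps" where "D = (\<Prod>i=1..6*n. 1 + fps_X ^ i)"
  define E :: "int fps" where "E = (\<Prod>i=1..6*n. 1 - fps_X ^ i)"
  define F :: "int fps" where "F = (\<Prod>i | i \<in> {1..6*n} \<and> 6 dvd i. 1 - fps_X ^ i)"
  define P :: "int fps" where "P = pentagonal n (fps_X ^ 6)"
  let ?g = "overpartition_gf 6 (6 * n)" and ?t = "1 + 2 * theta (6 * n)"
  have "{i \<in> {1..6*n}. 6 dvd i} = (\<lambda>i. 6 * i) ` {1..n}" by (auto elim!: dvdE)
  then have "F = (\<Prod>i=1..n. 1 - (fps_X ^ 6) ^ i)"
    by (simp add: F_def prod.reindex inj_on_def flip: power_mult)
  then have "(fps_X ^ 6) ^ Suc n dvd P - F"
    unfolding P_def by (simp only: power_dvd_pentagonal_diff)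
  moreover have "X dvd (fps_X ^ 6) ^ Suc n"
    unfolding X_def by (subst power_mult[symmetric], rule le_imp_power_dvd) simp
  ultimately have "X dvd D * (P - F)" using dvd_mult dvd_trans by blast
  moreover have "X dvd ?g * (D * ?t - E)"
    using fps_X_power_dvd_theta_diff[of "6 * n"] by (auto simp: X_def D_def E_def)
  ultimately have "X dvd ?g * (D * ?t - E) - D * (P - F)" by (rule dvd_diff[rotated])
  also have "?g * E = D * F" unfolding E_def D_def F_def by (rule overpartition_gf_mult)
  then have "?g * (D * ?t - E) - D * (P - F) = D * (?g * ?t - P)"
    by (simp add: algebra_simps)
  finally have "X dvd D * (?g * ?t - P)" .
  moreover have "fps_nth D 0 = 1"
  proof -
    have "fps_nth (\<Prod>i\<in>{1..k}. 1 + fps_X ^ i) 0 = (1 :: int)" for k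
      by (induction k) auto
    then show ?thesis by (simp add: D_def)
  qed
  ultimately show ?thesis
    using fps_X_power_dvd_mult_cancel unfolding X_def P_def by blast
qed

lemma fps_nth_numeral_mult: "fps_nth (numeral k * f) n = numeral k * fps_nth f n"
  by (simp add: numeral_fps_const)

lemma fps_nth_minus_one_power_mult:
  "fps_nth ((-1) ^ k * f) n = (-1) ^ k * fps_nth (f :: 'a :: comm_ring_1 fps) n"
  by (cases "even k") auto

lemma pentagonal_nth_eq_0:
  assumes "\<not> 3 dvd i"
  shows "fps_nth (pentagonal n (fps_X ^ 6)) i = (0 :: int)"
proof -
  have "i \<noteq> 0" using assms by (metis dvd_0_right)
  moreover have "i \<noteq> 6 * a + 6 * b" for a b using assms by presburger
  ultimately show ?thesis
    by (simp add: pentagonal_def fps_sum_nth fps_nth_minus_one_power_mult flip: power_mult)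
qed

lemma theta_nth_eq_0:
  assumes "\<And>k. i \<noteq> k\<^sup>2"
  shows "fps_nth (theta m) i = 0"
  using assms by (simp add: theta_def fps_sum_nth fps_nth_minus_one_power_mult)

lemma square_mod_3: "(k :: nat)\<^sup>2 mod 3 \<noteq> 2"
proof -
  have "k mod 3 \<in> {0, 1, 2}" by auto
  then have "(k mod 3)\<^sup>2 mod 3 \<noteq> 2" by auto
  then show ?thesis by (simp add: power_mod)
qed

lemma R_star_6_cong:
  assumes "N mod 3 = 2"
  shows "[int (R_star 6 N) = 4 * fps_nth (pentagonal N (fps_X ^ 6) * (theta (6 * N))\<^sup>2) N] (mod 8)"
proof -
  define g where "g = overpartition_gf 6 (6 * N)"
  define t where "t = theta (6 * N)"
  define P :: "int fps" where "P = pentagonal N (fps_X ^ 6)"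
  obtain h where "g * (1 + 2 * t) - P = fps_X ^ Suc (6 * N) * h"
    using overpartition_gf_theta[of N] unfolding g_def t_def P_def by (rule dvdE)
  then have g: "g * (1 + 2 * t) = P + fps_X ^ Suc (6 * N) * h"
    by (simp add: algebra_simps)
  \<comment> \<open>\<open>1 - 2 * t + 4 * t\<^sup>2\<close> inverts \<open>1 + 2 * t\<close> up to
    the explicit multiple \<open>8 * t ^ 3\<close> of 8.\<close>
  have "g + 8 * (g * t ^ 3) = g * (1 + 2 * t) * (1 - 2 * t + 4 * t\<^sup>2)"
    by (simp add: algebra_simps power2_eq_square power3_eq_cube)
  also have "\<dots> = P - 2 * (P * t) + 4 * (P * t\<^sup>2) +
      fps_X ^ Suc (6 * N) * (h * (1 - 2 * t + 4 * t\<^sup>2))"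
    unfolding g by (simp add: algebra_simps del: power_Suc)
  finally have "fps_nth (g + 8 * (g * t ^ 3)) N = fps_nth (P - 2 * (P * t) + 4 * (P * t\<^sup>2) +
      fps_X ^ Suc (6 * N) * (h * (1 - 2 * t + 4 * t\<^sup>2))) N" by simp
  \<comment> \<open>The truncation error starts at exponent \<open>6 * N + 1\<close> and does not
    reach \<open>N\<close>.\<close>
  then have "fps_nth g N + 8 * fps_nth (g * t ^ 3) N =
      fps_nth P N - 2 * fps_nth (P * t) N + 4 * fps_nth (P * t\<^sup>2) N"
    by (simp add: fps_nth_numeral_mult fps_X_power_mult_nth del: power_Suc)
  moreover have "fps_nth P N = 0"
    unfolding P_def by (rule pentagonal_nth_eq_0) (use assms in presburger)
  \<comment> \<open>\<open>P\<close> lives on exponents divisible by 3, which leaves for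
    \<open>t\<close> an exponent congruent to 2 modulo 3, never a square.\<close>
  moreover have "fps_nth (P * t) N = 0"
    unfolding fps_mult_nth
  proof (rule sum.neutral, rule ballI)
    fix i assume i: "i \<in> {0..N}"
    show "fps_nth P i * fps_nth t (N - i) = 0"
    proof (cases "3 dvd i")
      case True
      then obtain c where c: "i = 3 * c" by (rule dvdE)
      obtain d where d: "N = i + d" using i le_Suc_ex by auto
      have "d mod 3 = 2" using assms unfolding d c by simp
      then have "d \<noteq> k\<^sup>2" for k using square_mod_3[of k] by auto
      then have "fps_nth t (N - i) = 0" unfolding t_def d by (simp add: theta_nth_eq_0)
      then show ?thesis by simp
    qed (simp add: P_def pentagonal_nth_eq_0)
  qed
  ultimately have "fps_nth g N + 8 * fps_nth (g * t ^ 3) N = 4 * fps_nth (P * t\<^sup>2) N" by simp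
  moreover have "fps_nth g N = int (R_star 6 N)"
    by (simp add: g_def overpartition_gf_def card_bounded_overpartitions)
  ultimately have "int (R_star 6 N) - 4 * fps_nth (P * t\<^sup>2) N = 8 * - fps_nth (g * t ^ 3) N"
    by simp
  then show ?thesis unfolding P_def t_def cong_iff_dvd_diff by (rule dvdI)
qed

section \<open>Reduction modulo 2 to a count of lattice points\<close>

text \<open>The cross terms of the square come in equal pairs.\<close>

lemma two_dvd_sum_square:
  fixes f :: "'b \<Rightarrow> 'a :: comm_ring_1"
  assumes "finite A"
  shows "2 dvd (\<Sum>i\<in>A. f i)\<^sup>2 - (\<Sum>i\<in>A. (f i)\<^sup>2)"
  using assms
proof induction
  case (insert x A)
  have "(\<Sum>i\<in>insert x A. f i)\<^sup>2 - (\<Sum>i\<in>insert x A. (f i)\<^sup>2) =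
      2 * (f x * (\<Sum>i\<in>A. f i)) + ((\<Sum>i\<in>A. f i)\<^sup>2 - (\<Sum>i\<in>A. (f i)\<^sup>2))"
    using insert by (simp add: power2_eq_square algebra_simps)
  then show ?case using insert.IH by simp
qed simp

lemma two_dvd_theta_square: "2 dvd (theta m)\<^sup>2 - (\<Sum>a=1..m. fps_X ^ (2 * a\<^sup>2))"
proof -
  have eq: "((-1) ^ k * fps_X ^ k\<^sup>2)\<^sup>2 = (fps_X ^ (2 * k\<^sup>2) :: int fps)" for k :: nat
    by (simp add: power_mult_distrib mult.commute flip: power_mult)
  have "2 dvd (\<Sum>k=1..m. (-1) ^ k * fps_X ^ k\<^sup>2)\<^sup>2 - (\<Sum>k=1..m. ((-1) ^ k * fps_X ^ k\<^sup>2 :: int fps)\<^sup>2)"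
    by (rule two_dvd_sum_square) simp
  then show ?thesis unfolding theta_def eq .
qed

text \<open>The generalised pentagonal numbers are the numbers \<open>(x\<^sup>2 - 1) / 24\<close> with \<open>x\<close> coprime to 6.\<close>

lemma two_dvd_pentagonal:
  fixes q :: "'a :: comm_ring_1"
  shows "2 dvd pentagonal n (q ^ 6) -
    (\<Sum>x | x \<le> 6 * n + 1 \<and> odd x \<and> \<not> 3 dvd x. q ^ ((x\<^sup>2 - 1) div 4))"
proof (induction n)
  case 0
  have "{x. x \<le> 6 * 0 + 1 \<and> odd x \<and> \<not> 3 dvd x} = {1 :: nat}"
    by (auto simp: le_Suc_eq)
  then show ?case by (simp add: pentagonal_def)
next
  case (Suc m)
  let ?B = "\<lambda>n. {x. x \<le> 6 * n + 1 \<and> odd x \<and> \<not> 3 dvd x} :: nat set"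
  let ?f = "\<lambda>x. q ^ ((x\<^sup>2 - 1) div 4)"
  \<comment> \<open>For \<open>k = Suc m\<close> the new numbers are \<open>6k - 1\<close> and
    \<open>6k + 1\<close>. Their squares minus 1, divided by 4, are 6 times
    \<open>k (3k - 1) / 2\<close> and \<open>k (3k + 1) / 2\<close>, matching the new summands in
    \<open>q ^ 6\<close>.\<close>
  have B: "?B (Suc m) = insert (6 * m + 5) (insert (6 * m + 7) (?B m))"
    by (rule Set.set_eqI, simp) presburger
  have "finite (?B m)" by (rule finite_subset[of _ "{..6 * m + 1}"]) auto
  then have sumB: "sum ?f (?B (Suc m)) = ?f (6 * m + 5) + ?f (6 * m + 7) + sum ?f (?B m)"
    unfolding B by (simp add: add.assoc)
  have tri: "2 * (Suc k choose 2) = k * (k + 1)" for k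
    by (simp add: choose_two)
  have "((6 * m + 5)\<^sup>2 - 1) div 4 = 6 * ((Suc m)\<^sup>2 + (Suc m choose 2))"
    using tri[of m] by (simp add: power2_eq_square algebra_simps)
  moreover have "((6 * m + 7)\<^sup>2 - 1) div 4 = 6 * ((Suc m)\<^sup>2 + (Suc (Suc m) choose 2))"
    using tri[of "Suc m"] by (simp add: power2_eq_square algebra_simps)
  ultimately have P: "pentagonal (Suc m) (q ^ 6) =
      pentagonal m (q ^ 6) + (-1) ^ Suc m * (?f (6 * m + 5) + ?f (6 * m + 7))"
    unfolding pentagonal_def by (simp add: distrib_left del: binomial_Suc_Suc flip: power_mult)
  have "2 dvd (-1) ^ Suc m * a - (a :: 'a)" for a
  proof (cases "even m")
    case True
    then have "(-1) ^ Suc m * a - a = 2 * (- a)" by simp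
    then show ?thesis by (rule dvdI)
  qed simp
  from dvd_add[OF Suc.IH this[of "?f (6 * m + 5) + ?f (6 * m + 7)"]]
  show ?case unfolding P sumB by (simp add: algebra_simps)
qed

text \<open>Modulo 2 both factors are sums of monomials with coefficient 1, so the coefficient of
  the product counts pairs of exponents with sum \<open>N\<close>.\<close>

lemma parity_pentagonal_theta:
  defines "A \<equiv> \<lambda>N. {(x, a). x \<le> 6 * N + 1 \<and> odd x \<and> \<not> 3 dvd x \<and> 1 \<le> a \<and> a \<le> 6 * N \<and>
    (x\<^sup>2 - 1) div 4 + 2 * a\<^sup>2 = N}"
  shows "even (fps_nth (pentagonal N (fps_X ^ 6) * (theta (6 * N))\<^sup>2) N - int (card (A N)))"
proof -
  let ?B = "{x. x \<le> 6 * N + 1 \<and> odd x \<and> \<not> 3 dvd x}"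
  define P :: "int fps" where "P = pentagonal N (fps_X ^ 6)"
  define t where "t = theta (6 * N)"
  define P' :: "int fps" where "P' = (\<Sum>x\<in>?B. fps_X ^ ((x\<^sup>2 - 1) div 4))"
  define t' :: "int fps" where "t' = (\<Sum>a=1..6*N. fps_X ^ (2 * a\<^sup>2))"
  have "2 dvd (P - P') * t\<^sup>2 + P' * (t\<^sup>2 - t')"
    using two_dvd_pentagonal[of N fps_X] two_dvd_theta_square[of "6 * N"]
    unfolding P_def P'_def t_def t'_def by (intro dvd_add dvd_mult2 dvd_mult)
  also have "(P - P') * t\<^sup>2 + P' * (t\<^sup>2 - t') = P * t\<^sup>2 - P' * t'" by (simp add: algebra_simps)
  finally obtain h where "P * t\<^sup>2 - P' * t' = 2 * h" by (rule dvdE)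
  then have "fps_nth (P * t\<^sup>2 - P' * t') N = 2 * fps_nth h N"
    by (simp only: fps_nth_numeral_mult)
  then have ev: "even (fps_nth (P * t\<^sup>2) N - fps_nth (P' * t') N)" by simp
  have fin: "finite ?B" by (rule finite_subset[of _ "{..6 * N + 1}"]) auto
  have "P' * t' = (\<Sum>(x, a)\<in>?B \<times> {1..6*N}. fps_X ^ ((x\<^sup>2 - 1) div 4 + 2 * a\<^sup>2))"
    unfolding P'_def t'_def sum_product by (simp add: sum.cartesian_product power_add)
  then have "fps_nth (P' * t') N =
      (\<Sum>(x, a)\<in>?B \<times> {1..6*N}. if N = (x\<^sup>2 - 1) div 4 + 2 * a\<^sup>2 then 1 else 0)"
    by (simp add: fps_sum_nth case_prod_unfold)
  also have "\<dots> = int (card {z \<in> ?B \<times> {1..6*N}. case z of (x, a) \<Rightarrow> N = (x\<^sup>2 - 1) div 4 + 2 * a\<^sup>2})"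
    using fin by (simp add: case_prod_unfold sum.If_cases Int_def)
  also have "{z \<in> ?B \<times> {1..6*N}. case z of (x, a) \<Rightarrow> N = (x\<^sup>2 - 1) div 4 + 2 * a\<^sup>2} = A N"
    by (auto simp: A_def)
  finally show ?thesis using ev by (simp add: P_def t_def)
qed

text \<open>As \<open>4 * N + 1 = 9 * (8 * m + 1)\<close>, multiplying the equation in
  \<open>A\<close> by 4 and adding 1 gives \<open>x\<^sup>2 + 2 * (2 * a)\<^sup>2 = 9 * M\<close>.
  So \<open>A\<close> corresponds to the positive representations of \<open>9 * M\<close> with
  \<open>x\<close> prime to 3.\<close>

lemma R_star_6_mod_8:
  assumes "\<not> is_square (int (8 * m + 1))"
  shows "[R_star 6 (18 * m + 2) = 0] (mod 8)"
proof -
  define N where "N = 18 * m + 2"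
  define M where "M = int (8 * m + 1)"
  define A where "A = {(x, a). x \<le> 6 * N + 1 \<and> odd x \<and> \<not> 3 dvd x \<and> 1 \<le> a \<and> a \<le> 6 * N \<and>
    (x\<^sup>2 - 1) div 4 + 2 * a\<^sup>2 = N}"
  let ?B = "{(x, y) \<in> reps (9 * M). \<not> 3 dvd x \<and> x > 0 \<and> y > 0}"
  have key: "(x\<^sup>2 - 1) div 4 + 2 * a\<^sup>2 = N \<longleftrightarrow> (int x)\<^sup>2 + 2 * (int (2 * a))\<^sup>2 = 9 * M"
    if "odd x" for x a
  proof -
    from that obtain b where b: "x = 2 * b + 1" by (rule oddE)
    define c where "c = b * b + b"
    have x: "x\<^sup>2 = 4 * c + 1" by (simp add: b c_def power2_eq_square algebra_simps)
    have int: "(int x)\<^sup>2 + 2 * (int (2 * a))\<^sup>2 = int (x\<^sup>2 + 8 * a\<^sup>2)" "9 * M = int (9 * (8 * m + 1))"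
      by (simp_all add: M_def power2_eq_square)
    have "x\<^sup>2 + 8 * a\<^sup>2 = 9 * (8 * m + 1) \<longleftrightarrow> c + 2 * a\<^sup>2 = N"
      unfolding x N_def by auto
    moreover have "(x\<^sup>2 - 1) div 4 = c" unfolding x by simp
    ultimately show ?thesis by (simp only: int of_nat_eq_iff)
  qed
  have "bij_betw (\<lambda>(x, a). (int x, int (2 * a))) A ?B"
  proof (rule bij_betwI')
    fix u v :: "nat \<times> nat"
    show "(case u of (x, a) \<Rightarrow> (int x, int (2 * a))) = (case v of (x, a) \<Rightarrow> (int x, int (2 * a)))
      \<longleftrightarrow> u = v" by (auto simp: case_prod_unfold prod_eq_iff)
  next
    fix u assume "u \<in> A"
    then obtain x a where u: "u = (x, a)" "odd x" "\<not> 3 dvd x" "1 \<le> a"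
      "(x\<^sup>2 - 1) div 4 + 2 * a\<^sup>2 = N" by (auto simp: A_def)
    have "(int x)\<^sup>2 + 2 * (int (2 * a))\<^sup>2 = 9 * M" using key[OF u(2)] u(5) by blast
    moreover have "\<not> 3 dvd int x" using u(3) by presburger
    moreover have "x > 0" using u(2) by (rule odd_pos)
    ultimately show "(case u of (x, a) \<Rightarrow> (int x, int (2 * a))) \<in> ?B"
      using u by (simp add: reps_def)
  next
    fix v assume "v \<in> ?B"
    then obtain x y where v: "v = (int x, int y)" "x\<^sup>2 + 2 * y\<^sup>2 = 9 * (8 * m + 1)"
      "\<not> 3 dvd x" "x > 0" "y > 0"
    proof -
      assume that: "\<And>x y. v = (int x, int y) \<Longrightarrow> x\<^sup>2 + 2 * y\<^sup>2 = 9 * (8 * m + 1) \<Longrightarrow>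
        \<not> 3 dvd x \<Longrightarrow> x > 0 \<Longrightarrow> y > 0 \<Longrightarrow> thesis"
      obtain x' y' where v': "v = (x', y')" "x'\<^sup>2 + 2 * y'\<^sup>2 = 9 * M" "\<not> 3 dvd x'" "x' > 0" "y' > 0"
        using \<open>v \<in> ?B\<close> by (auto simp: reps_def)
      then obtain x y where xy: "x' = int x" "y' = int y"
        using zero_le_imp_eq_int[of x'] zero_le_imp_eq_int[of y'] by auto
      have "int (x\<^sup>2 + 2 * y\<^sup>2) = int (9 * (8 * m + 1))"
        using v'(2) by (simp add: xy M_def)
      then have "x\<^sup>2 + 2 * y\<^sup>2 = 9 * (8 * m + 1)" by (simp only: of_nat_eq_iff)
      then show thesis using v' xy by (intro that[of x y]) (auto simp: int_dvd_int_iff[of 3, simplified])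
    qed
    have even_if: "even v" if "[u = 1] (mod 8)" "[u + 2 * v = 1] (mod 8)" for u v :: nat
    proof -
      have "[u + 2 * v = u + 0] (mod 8)" using cong_trans[OF that(2) cong_sym[OF that(1)]] by simp
      then have "[2 * v = 0] (mod 8)" by (simp only: cong_add_lcancel_nat)
      then have "8 dvd 2 * v" by (simp add: cong_0_iff)
      then obtain c where "2 * v = 8 * c" by (rule dvdE)
      then have "v = 2 * (2 * c)" by simp
      then show ?thesis by (rule dvdI)
    qed
    \<comment> \<open>Modulo 8 both \<open>x\<^sup>2\<close> and the right-hand side are 1, so
      \<open>8 dvd 2 * y\<^sup>2\<close> and \<open>y\<close> is twice some
      \<open>a\<close>.\<close>
    have "odd (x\<^sup>2 + 2 * y\<^sup>2)" unfolding v(2) by simp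
    then have x: "odd x" by simp
    then have "[x\<^sup>2 = 1] (mod 8)" unfolding square_mod_8_eq_1_iff .
    moreover have "[x\<^sup>2 + 2 * y\<^sup>2 = 1] (mod 8)" unfolding v(2) cong_def by presburger
    ultimately have "even (y\<^sup>2)" by (rule even_if)
    then obtain a where a: "y = 2 * a" by auto
    then have "(x\<^sup>2 - 1) div 4 + 2 * a\<^sup>2 = N"
      using key[OF x, of a] v(2) by (simp add: M_def power2_eq_square flip: of_nat_mult of_nat_add)
    \<comment> \<open>The truncation bounds in \<open>A\<close> lose no solution:
      \<open>x \<le> x\<^sup>2 \<le> 9 * (8 * m + 1) \<le> 6 * N + 1\<close> and
      \<open>a \<le> a\<^sup>2 \<le> N\<close>.\<close>
    moreover have "x \<le> x\<^sup>2" "a \<le> a\<^sup>2" by (simp_all add: power2_eq_square)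
    moreover have "x\<^sup>2 \<le> 9 * (8 * m + 1)" using v(2) by linarith
    moreover have "9 * (8 * m + 1) \<le> 6 * N + 1" by (simp add: N_def)
    ultimately have "(x, a) \<in> A" using v a x unfolding A_def by auto
    then show "\<exists>u\<in>A. v = (case u of (x, a) \<Rightarrow> (int x, int (2 * a)))"
      using v(1) a by (intro bexI[of _ "(x, a)"]) auto
  qed
  then have "card A = card ?B" by (rule bij_betw_same_card)
  moreover have "even (card ?B)"
    using assms by (intro even_card_reps_9) (auto simp: M_def cong_def)
  ultimately have "even (fps_nth (pentagonal N (fps_X ^ 6) * (theta (6 * N))\<^sup>2) N)"
    using parity_pentagonal_theta[of N] unfolding A_def by simp
  then have "[4 * fps_nth (pentagonal N (fps_X ^ 6) * (theta (6 * N))\<^sup>2) N = 0] (mod 8)"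
    by (auto simp: cong_0_iff elim!: evenE)
  moreover have "N mod 3 = 2" unfolding N_def by presburger
  ultimately have "[int (R_star 6 N) = 0] (mod 8)"
    using R_star_6_cong cong_trans by blast
  then have "[int (R_star 6 N) = int 0] (mod int 8)" by simp
  then show ?thesis unfolding N_def cong_int_iff .
qed

section \<open>The arithmetic progressions\<close>

text \<open>Once the square \<open>p ^ (2 * k)\<close> is cancelled, a square root of
  \<open>8 * p * n + s\<close> would make \<open>s\<close> a quadratic residue modulo
  \<open>p\<close>.\<close>

lemma not_square_if_Legendre:
  assumes "prime p" "Legendre (int s) (int p) = -1"
  shows "\<not> is_square (int (p ^ (2 * k) * (8 * p * n + s)))"
proof
  assume sq: "is_square (int (p ^ (2 * k) * (8 * p * n + s)))"
  have "int (p ^ (2 * k)) = (int p ^ k)\<^sup>2" by (simp add: mult.commute flip: power_mult)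
  then have "is_square ((int p ^ k)\<^sup>2 * int (8 * p * n + s))"
    using sq by (simp only: of_nat_mult)
  moreover have "(int p ^ k)\<^sup>2 \<noteq> 0" using prime_gt_0_nat[OF assms(1)] by simp
  ultimately have "is_square (int (8 * p * n + s))"
    using is_nth_power_mult_cancel_left[OF is_nth_power_nth_power] by blast
  then obtain c where "int (8 * p * n + s) = c\<^sup>2" by (elim is_nth_powerE)
  then have "c\<^sup>2 = int s + int p * (8 * int n)" by simp
  then have "[c\<^sup>2 = int s] (mod int p)" unfolding cong_def by simp
  then have "QuadRes (int p) (int s)" by (auto simp: QuadRes_def)
  then show False using assms(2) by (simp add: Legendre_def split: if_splits)
qed

text \<open>Odd squares are 1 modulo 8, so \<open>s * p ^ (2 * k) = 8 * j + 1\<close>. The argument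
  is then \<open>18 * m + 2\<close> with
  \<open>8 * m + 1 = p ^ (2 * k) * (8 * p * n + s)\<close>.\<close>

lemma R_star_6_progression:
  assumes "prime p" "odd p" "[s = 1] (mod 8)" "Legendre (int s) (int p) = -1"
  shows "[R_star 6 (18 * p ^ (2 * k + 1) * n + (9 * s * p ^ (2 * k) - 1) div 4) = 0] (mod 8)"
proof -
  have "[(p ^ k)\<^sup>2 = 1] (mod 8)" unfolding square_mod_8_eq_1_iff using assms(2) by simp
  then have "[p ^ (2 * k) = 1] (mod 8)" by (simp add: mult.commute flip: power_mult)
  with assms(3) have "[s * p ^ (2 * k) = 1 * 1] (mod 8)" by (rule cong_mult)
  then have "s * p ^ (2 * k) mod 8 = 1" by (simp add: cong_def)
  then obtain j where j: "s * p ^ (2 * k) = 8 * j + 1"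
    using mult_div_mod_eq[of 8 "s * p ^ (2 * k)"] by metis
  define m where "m = p ^ (2 * k + 1) * n + j"
  have "9 * s * p ^ (2 * k) = 9 * (s * p ^ (2 * k))" by simp
  then have "18 * p ^ (2 * k + 1) * n + (9 * s * p ^ (2 * k) - 1) div 4 = 18 * m + 2"
    unfolding j by (simp add: m_def)
  moreover have "p ^ (2 * k) * (8 * p * n + s) = 8 * (p ^ (2 * k + 1) * n) + s * p ^ (2 * k)"
    by (simp add: algebra_simps)
  then have M: "p ^ (2 * k) * (8 * p * n + s) = 8 * m + 1" unfolding j by (simp add: m_def)
  have "\<not> is_square (int (8 * m + 1))"
    using not_square_if_Legendre[OF assms(1,4), of k n] unfolding M .
  then have "[R_star 6 (18 * m + 2) = 0] (mod 8)" by (rule R_star_6_mod_8)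
  ultimately show ?thesis by (simp only:)
qed

theorem theorem1p12:
  fixes p s :: nat
  assumes "prime p" and "odd p"
    and "1 \<le> s" and "s \<le> 8 * p" and "[s = 1] (mod 8)"
    and "Legendre (int s) (int p) = -1"
  shows "(\<forall>n. [R_star 6 (18 * p * n + (9 * s - 1) div 4) = 0] (mod 8)) \<and>
    ([ramanujan_tau p = 0] (mod 2) \<longrightarrow>
      (\<forall>n k. k \<ge> 1 \<longrightarrow>
        [R_star 6 (18 * p ^ (2 * k + 1) * n + (9 * s * p ^ (2 * k) - 1) div 4) = 0] (mod 8)))"
  \<comment> \<open>The instance \<open>k = 0\<close> is the first progression.\<close>
  using R_star_6_progression[OF assms(1,2,5,6), of 0]
    R_star_6_progression[OF assms(1,2,5,6)] by simp

end
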